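(* Let $a,b,c,d$ be real numbers with $d\neq 0$, and consider the system of difference equations $$x_{n+1}=\frac{a\,y_{n-2}x_{n-1}y_n+b\,x_{n-1}y_{n-2}+c\,y_{n-2}+d}{y_{n-2}x_{n-1}y_n},\qquad y_{n+1}=\frac{a\,x_{n-2}y_{n-1}x_n+b\,y_{n-1}x_{n-2}+c\,x_{n-2}+d}{x_{n-2}y_{n-1}x_n},\qquad n\in\mathbb{N}_0,$$ with nonzero real initial values $x_{-2},x_{-1},x_0,y_{-2},y_{-1},y_0$. Let $(J_n)_{n\ge 0}$ be the sequence defined by $J_0=J_1=0$, $J_2=1$, $J_3=a$ and $J_{n+4}=aJ_{n+3}+bJ_{n+2}+cJ_{n+1}+dJ_n$ for $n\in\mathbb{N}_0$. (i) If $\{x_n,y_n\}_{n\ge -2}$ is a well defined solution of the system, then for every $n\in\mathbb{N}_0$ $$x_{2n+1}=\frac{dJ_{2n+2}+(cJ_{2n+2}+dJ_{2n+1})y_{-2}+(J_{2n+4}-aJ_{2n+3})x_{-1}y_{-2}+J_{2n+3}\,y_0x_{-1}y_{-2}}{dJ_{2n+1}+(cJ_{2n+1}+dJ_{2n})y_{-2}+(J_{2n+3}-aJ_{2n+2})x_{-1}y_{-2}+J_{2n+2}\,y_0x_{-1}y_{-2}},$$ $$x_{2n+2}=\frac{dJ_{2n+3}+(cJ_{2n+3}+dJ_{2n+2})x_{-2}+(J_{2n+5}-aJ_{2n+4})y_{-1}x_{-2}+J_{2n+4}\,x_0y_{-1}x_{-2}}{dJ_{2n+2}+(cJ_{2n+2}+dJ_{2n+1})x_{-2}+(J_{2n+4}-aJ_{2n+3})y_{-1}x_{-2}+J_{2n+3}\,x_0y_{-1}x_{-2}},$$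 $$y_{2n+1}=\frac{dJ_{2n+2}+(cJ_{2n+2}+dJ_{2n+1})x_{-2}+(J_{2n+4}-aJ_{2n+3})y_{-1}x_{-2}+J_{2n+3}\,x_0y_{-1}x_{-2}}{dJ_{2n+1}+(cJ_{2n+1}+dJ_{2n})x_{-2}+(J_{2n+3}-aJ_{2n+2})y_{-1}x_{-2}+J_{2n+2}\,x_0y_{-1}x_{-2}},$$ $$y_{2n+2}=\frac{dJ_{2n+3}+(cJ_{2n+3}+dJ_{2n+2})y_{-2}+(J_{2n+5}-aJ_{2n+4})x_{-1}y_{-2}+J_{2n+4}\,y_0x_{-1}y_{-2}}{dJ_{2n+2}+(cJ_{2n+2}+dJ_{2n+1})y_{-2}+(J_{2n+4}-aJ_{2n+3})x_{-1}y_{-2}+J_{2n+3}\,y_0x_{-1}y_{-2}}.$$ (ii) The forbidden set of the system, i.e. the set of $(x_{-2},x_{-1},x_0,y_{-2},y_{-1},y_0)\in(\mathbb{R}\setminus\{0\})^6$ that are not the initial values of a well defined solution, is $$F=\bigcup_{n=0}^{\infty}\left\{(x_{-2},x_{-1},x_0,y_{-2},y_{-1},y_0)\in(\mathbb{R}\setminus\{0\})^6:\ A_n=0\ \text{or}\ B_n=0\right\},$$ where $$A_n=dJ_{n+1}+(cJ_{n+1}+dJ_n)y_{-2}+(J_{n+3}-aJ_{n+2})x_{-1}y_{-2}+J_{n+2}\,y_0x_{-1}y_{-2},$$ $$B_n=dJ_{n+1}+(cJ_{n+1}+dJ_n)x_{-2}+(J_{n+3}-aJ_{n+2})y_{-1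}x_{-2}+J_{n+2}\,x_0y_{-1}x_{-2}.$$
   Context: $\mathbb{N}_0=\{0,1,2,\dots\}$. A well defined solution of the system is a pair of real sequences $(x_n)_{n\ge -2}$, $(y_n)_{n\ge -2}$ satisfying both recurrences for all $n\in\mathbb{N}_0$ and such that $x_ny_n\neq 0$ for all $n\ge -2$. *)

theory Defs
  imports Complex_Main
begin

text \<open>
  Sequences indexed by \<open>n \<ge> -2\<close> are functions on \<^typ>\<open>int\<close> of which only the values at
  arguments \<open>\<ge> -2\<close> are ever constrained or inspected. Since no term \<open>x n\<close>, \<open>y n\<close> with
  \<open>n \<ge> -2\<close> vanishes, no division by zero occurs in the recurrences.
\<close>

definition well_defined_solution ::
    "real \<Rightarrow> real \<Rightarrow> real \<Rightarrow> real \<Rightarrow> (int \<Rightarrow> real) \<Rightarrow> (int \<Rightarrow> real) \<Rightarrow> bool" where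
  "well_defined_solution a b c d x y \<longleftrightarrow>
     (\<forall>n\<ge>0.
        x (n + 1) = (a * y (n - 2) * x (n - 1) * y n + b * x (n - 1) * y (n - 2) + c * y (n - 2) + d)
                    / (y (n - 2) * x (n - 1) * y n) \<and>
        y (n + 1) = (a * x (n - 2) * y (n - 1) * x n + b * y (n - 1) * x (n - 2) + c * x (n - 2) + d)
                    / (x (n - 2) * y (n - 1) * x n)) \<and>
     (\<forall>n\<ge>-2. x n * y n \<noteq> 0)"

text \<open>Tuples are ordered as \<open>(x\<^sub>-\<^sub>2, x\<^sub>-\<^sub>1, x\<^sub>0, y\<^sub>-\<^sub>2, y\<^sub>-\<^sub>1, y\<^sub>0)\<close>.\<close>

definition forbidden_set ::
    "real \<Rightarrow> real \<Rightarrow> real \<Rightarrow> real \<Rightarrow> (real \<times> real \<times> real \<times> real \<times> real \<times> real) set" where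
  "forbidden_set a b c d =
     {(p2, p1, p0, q2, q1, q0).
        p2 \<noteq> 0 \<and> p1 \<noteq> 0 \<and> p0 \<noteq> 0 \<and> q2 \<noteq> 0 \<and> q1 \<noteq> 0 \<and> q0 \<noteq> 0 \<and>
        \<not> (\<exists>x y. well_defined_solution a b c d x y \<and>
              x (-2) = p2 \<and> x (-1) = p1 \<and> x 0 = p0 \<and>
              y (-2) = q2 \<and> y (-1) = q1 \<and> y 0 = q0)}"

end

theory Submission imports Defs begin

text \<open>
  The interleaved sequences $y_{-2}, x_{-1}, y_0, x_1, \ldots$ and
  $x_{-2}, y_{-1}, x_0, y_1, \ldots$ decouple the system: each satisfies
  $u_{k+3} = a + b/u_{k+2} + c/(u_{k+2} u_{k+1}) + d/(u_{k+2} u_{k+1} u_k)$. The partial products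
  $w_k = u_0 \cdots u_{k-1}$ turn this into the linear recurrence with the coefficients of $J$, so
  $w_{n+3}$ is a combination of values of $J$, namely $A_n$ or $B_n$. Hence a solution is given by
  the ratios $w_{k+1}/w_k$, and it exists exactly when no $w_k$ vanishes.
\<close>

text \<open>Index \<open>k\<close> stands for the original index \<open>k - 2\<close>. The
  right-hand side keeps the unsimplified fraction of the system, so passing between the two is pure
  substitution.\<close>

definition riccati_solution :: "real \<Rightarrow> real \<Rightarrow> real \<Rightarrow> real \<Rightarrow> (nat \<Rightarrow> real) \<Rightarrow> bool" where
  "riccati_solution a b c d u \<longleftrightarrow>
     (\<forall>k. u (k + 3) = (a * u k * u (k + 1) * u (k + 2) + b * u (k + 1) * u k + c * u k + d)
                      / (u k * u (k + 1) * u (k + 2))) \<and>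
     (\<forall>k. u k \<noteq> 0)"

definition interleave :: "(int \<Rightarrow> real) \<Rightarrow> (int \<Rightarrow> real) \<Rightarrow> nat \<Rightarrow> real" where
  "interleave f g k = (if even k then f (int k - 2) else g (int k - 2))"

text \<open>The initial values are the partial products of \<open>p, q, r\<close>, starting from the
  empty product; these parameters stand for \<open>u 0, u 1, u 2\<close>.\<close>

fun linrec :: "real \<Rightarrow> real \<Rightarrow> real \<Rightarrow> real \<Rightarrow> real \<Rightarrow> real \<Rightarrow> real \<Rightarrow> nat \<Rightarrow> real" where
  "linrec a b c d p q r 0 = 1"
| "linrec a b c d p q r (Suc 0) = p"
| "linrec a b c d p q r (Suc (Suc 0)) = q * p"
| "linrec a b c d p q r (Suc (Suc (Suc 0))) = r * q * p"
| "linrec a b c d p q r (Suc (Suc (Suc (Suc n)))) =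
     a * linrec a b c d p q r (Suc (Suc (Suc n))) + b * linrec a b c d p q r (Suc (Suc n))
     + c * linrec a b c d p q r (Suc n) + d * linrec a b c d p q r n"

text \<open>As functions of \<open>n\<close>, both sides satisfy the same linear recurrence of order
  four, so agreement at four consecutive indices suffices. The coefficient
  \<open>J (n + 3) - a * J (n + 2)\<close> equals
  \<open>b * J (n + 1) + c * J n + d * J (n - 1)\<close> for \<open>n\<close> \<ge> 1; written as a
  difference it needs no index below 0.\<close>

lemma linrec_closed_form:
  fixes a b c d :: real and J :: "nat \<Rightarrow> real"
  assumes J: "J 0 = 0" "J 1 = 0" "J 2 = 1" "J 3 = a"
    and rec: "\<And>n. J (n + 4) = a * J (n + 3) + b * J (n + 2) + c * J (n + 1) + d * J n"
  shows "linrec a b c d p q r (n + 3) =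
    d * J (n + 1) + (c * J (n + 1) + d * J n) * p + (J (n + 3) - a * J (n + 2)) * q * p
    + J (n + 2) * r * q * p"
proof -
  let ?w = "linrec a b c d p q r"
  define A where "A n = d * J (n + 1) + (c * J (n + 1) + d * J n) * p
    + (J (n + 3) - a * J (n + 2)) * q * p + J (n + 2) * r * q * p" for n
  have J4: "J 4 = a * J 3 + b * J 2 + c * J 1 + d * J 0"
    and J5: "J 5 = a * J 4 + b * J 3 + c * J 2 + d * J 1"
    and J6: "J 6 = a * J 5 + b * J 4 + c * J 3 + d * J 2"
    using rec[of 0] rec[of 1] rec[of 2] by (simp_all add: numeral_eq_Suc)
  have J_Suc: "J (Suc (Suc 0)) = 1" "J (Suc (Suc (Suc 0))) = a"
    using J by (simp_all add: numeral_eq_Suc)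
  have w_rec: "?w (n + 4) = a * ?w (n + 3) + b * ?w (n + 2) + c * ?w (n + 1) + d * ?w n" for n
    by (simp add: numeral_eq_Suc)
  have A_rec: "A (n + 4) = a * A (n + 3) + b * A (n + 2) + c * A (n + 1) + d * A n" for n
  proof -
    have e: "n + 4 + 1 = n + 1 + 4" "n + 4 + 3 = n + 3 + 4" "n + 4 + 2 = n + 2 + 4" by simp_all
    show ?thesis
      unfolding A_def e rec by (simp add: algebra_simps numeral_eq_Suc)
  qed
  have w3: "?w 0 = 1" "?w 1 = p" "?w 2 = q * p" "?w 3 = r * q * p"
    by (simp_all add: numeral_eq_Suc)
  have w4: "?w 4 = a * ?w 3 + b * ?w 2 + c * ?w 1 + d * ?w 0"
    and w5: "?w 5 = a * ?w 4 + b * ?w 3 + c * ?w 2 + d * ?w 1"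
    and w6: "?w 6 = a * ?w 5 + b * ?w 4 + c * ?w 3 + d * ?w 2"
    by (simp_all add: numeral_eq_Suc)
  have base: "?w 3 = A 0" "?w 4 = A 1" "?w 5 = A 2" "?w 6 = A 3"
    using J by (simp_all add: w4 w5 w6 w3 J4 J5 J6 J_Suc A_def algebra_simps)
  \<comment> \<open>Four consecutive equalities are carried through the induction, matching the
    order of the recurrence.\<close>
  have "?w (n + 3) = A n \<and> ?w (n + 4) = A (n + 1) \<and> ?w (n + 5) = A (n + 2)
      \<and> ?w (n + 6) = A (n + 3)"
  proof (induction n)
    case 0
    then show ?case using base by (simp add: numeral_eq_Suc del: linrec.simps)
  next
    case (Suc n)
    have "?w (n + 3 + 4) = A (n + 4)"
      unfolding A_rec w_rec using Suc by (simp add: numeral_eq_Suc del: linrec.simps)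
    with Suc show ?case by (simp add: numeral_eq_Suc del: linrec.simps)
  qed
  then show ?thesis unfolding A_def by blast
qed

text \<open>Once \<open>w (k + 1) = u k * w k\<close> is known, nonvanishing propagates from
  \<open>w 0 = 1\<close> and the ratio formula is a division.\<close>

lemma riccati_solution_linrec:
  assumes "riccati_solution a b c d u"
  shows "linrec a b c d (u 0) (u 1) (u 2) n \<noteq> 0"
    and "u n = linrec a b c d (u 0) (u 1) (u 2) (Suc n) / linrec a b c d (u 0) (u 1) (u 2) n"
proof -
  let ?w = "linrec a b c d (u 0) (u 1) (u 2)"
  have nz: "u k \<noteq> 0" for k using assms by (simp add: riccati_solution_def)
  have rec: "u (k + 3) * (u k * u (k + 1) * u (k + 2)) =
      a * u k * u (k + 1) * u (k + 2) + b * u (k + 1) * u k + c * u k + d" for k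
    using assms nz by (simp add: riccati_solution_def)
  have step: "?w (n + 1) = u n * ?w n \<and> ?w (n + 2) = u (n + 1) * ?w (n + 1)
      \<and> ?w (n + 3) = u (n + 2) * ?w (n + 2)" for n
  proof (induction n)
    case 0
    then show ?case by (simp add: numeral_eq_Suc)
  next
    case (Suc n)
    then have w: "?w (n + 1) = u n * ?w n" "?w (n + 2) = u (n + 1) * (u n * ?w n)"
        "?w (n + 3) = u (n + 2) * (u (n + 1) * (u n * ?w n))"
      by simp_all
    have "?w (n + 4) = a * ?w (n + 3) + b * ?w (n + 2) + c * ?w (n + 1) + d * ?w n"
      by (simp add: numeral_eq_Suc)
    \<comment> \<open>All four terms are multiples of \<open>w n\<close>; the remaining factor is
      the numerator of the nonlinear recurrence, which \<open>rec\<close> rewrites as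
      \<open>u (n + 3)\<close> times the product taking \<open>w n\<close> to
      \<open>w (n + 3)\<close>.\<close>
    also have "\<dots> = (a * u n * u (n + 1) * u (n + 2) + b * u (n + 1) * u n + c * u n + d) * ?w n"
      unfolding w by (simp add: algebra_simps)
    also have "\<dots> = u (n + 3) * ?w (n + 3)"
      unfolding rec[symmetric] w by (simp add: algebra_simps)
    finally show ?case using Suc by (simp add: numeral_eq_Suc)
  qed
  show nz_w: "?w n \<noteq> 0"
  proof (induction n)
    case (Suc n)
    then show ?case using step[of n] nz by simp
  qed simp
  show "u n = ?w (Suc n) / ?w n" using step[of n] nz_w by simp
qed

text \<open>Products of consecutive ratios telescope, the denominator to
  \<open>w (k + 3) / w k\<close>, so the claim is the linear recurrence divided by
  \<open>w (k + 3)\<close>.\<close>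

lemma linrec_riccati_solution:
  assumes nz: "\<And>n. linrec a b c d p q r n \<noteq> 0"
  shows "riccati_solution a b c d (\<lambda>n. linrec a b c d p q r (Suc n) / linrec a b c d p q r n)"
  unfolding riccati_solution_def
proof (intro conjI allI)
  fix k
  let ?w = "linrec a b c d p q r"
  let ?u = "\<lambda>n. ?w (Suc n) / ?w n"
  have "?w (k + 4) = a * ?w (k + 3) + b * ?w (k + 2) + c * ?w (k + 1) + d * ?w k"
    by (simp add: numeral_eq_Suc)
  moreover have "?w k \<noteq> 0" "?w (k + 1) \<noteq> 0" "?w (k + 2) \<noteq> 0" "?w (k + 3) \<noteq> 0"
    using nz by blast+
  ultimately have
    "?w (k + 4) / ?w (k + 3) =
      (a * (?w (k + 1) / ?w k) * (?w (k + 2) / ?w (k + 1)) * (?w (k + 3) / ?w (k + 2))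
        + b * (?w (k + 2) / ?w (k + 1)) * (?w (k + 1) / ?w k) + c * (?w (k + 1) / ?w k) + d)
      / (?w (k + 1) / ?w k * (?w (k + 2) / ?w (k + 1)) * (?w (k + 3) / ?w (k + 2)))"
    by (simp add: field_simps)
  moreover have "Suc (k + 3) = k + 4" "Suc (k + 2) = k + 3" "Suc (k + 1) = k + 2" "Suc k = k + 1"
    by simp_all
  ultimately show "?u (k + 3) =
      (a * ?u k * ?u (k + 1) * ?u (k + 2) + b * ?u (k + 1) * ?u k + c * ?u k + d)
      / (?u k * ?u (k + 1) * ?u (k + 2))"
    by (simp only:)
  show "?u k \<noteq> 0" using nz by simp
qed

text \<open>For even \<open>k\<close>, the recurrence of \<open>interleave y x\<close> at
  \<open>k\<close> is the equation for \<open>x\<close> at \<open>n = k\<close>, and that of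
  \<open>interleave x y\<close> is the equation for \<open>y\<close>. For odd \<open>k\<close> the
  roles swap, so the two sequences together encode exactly the system.\<close>

lemma well_defined_solution_iff_interleave:
  "well_defined_solution a b c d x y \<longleftrightarrow>
     riccati_solution a b c d (interleave y x) \<and> riccati_solution a b c d (interleave x y)"
proof -
  have all_ge: "(\<forall>n\<ge>m. P n) \<longleftrightarrow> (\<forall>k::nat. P (int k + m))" for P and m :: int
    by (metis add.commute add_increasing2 diff_add_cancel diff_ge_0_iff_ge le_add_same_cancel1
        of_nat_0_le_iff zero_le_imp_eq_int)
  have shift: "int (k + 1) - 2 = int k - 1" "int (k + 2) - 2 = int k" "int (k + 3) - 2 = int k + 1"
    for k
    by simp_all
  have "well_defined_solution a b c d x y \<longleftrightarrow>
     (\<forall>k. x (int k + 1) = (a * y (int k - 2) * x (int k - 1) * y (int k)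
            + b * x (int k - 1) * y (int k - 2) + c * y (int k - 2) + d)
            / (y (int k - 2) * x (int k - 1) * y (int k)) \<and>
        y (int k + 1) = (a * x (int k - 2) * y (int k - 1) * x (int k)
            + b * y (int k - 1) * x (int k - 2) + c * x (int k - 2) + d)
            / (x (int k - 2) * y (int k - 1) * x (int k))) \<and>
     (\<forall>k. x (int k - 2) \<noteq> 0 \<and> y (int k - 2) \<noteq> 0)" (is "_ \<longleftrightarrow> ?rhs")
    unfolding well_defined_solution_def all_ge by simp
  also have "\<dots> \<longleftrightarrow>
      riccati_solution a b c d (interleave y x) \<and> riccati_solution a b c d (interleave x y)"
  proof -
    define R where "R u k \<longleftrightarrow> u (k + 3) =
        (a * u k * u (k + 1) * u (k + 2) + b * u (k + 1) * u k + c * u k + d)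
        / (u k * u (k + 1) * u (k + 2))" for u :: "nat \<Rightarrow> real" and k
    have "riccati_solution a b c d (interleave y x) \<and> riccati_solution a b c d (interleave x y)
        \<longleftrightarrow> (\<forall>k. R (interleave y x) k \<and> R (interleave x y) k) \<and>
            (\<forall>k. interleave x y k \<noteq> 0 \<and> interleave y x k \<noteq> 0)"
      unfolding riccati_solution_def R_def by blast
    also have "\<dots> \<longleftrightarrow> ?rhs"
      \<comment> \<open>The comparison is made separately for each \<open>k\<close>; its parity only
        decides the order of the two conjuncts.\<close>
      by (rule arg_cong2[where f = "(\<and>)"]; rule all_cong1)
        (auto simp: R_def interleave_def shift add.commute[of 1 "int k" for k])
    finally show ?thesis by (rule sym)
  qed
  finally show ?thesis .
qed

lemma interleave_initial [simp]:
  "interleave f g 0 = f (-2)" "interleave f g (Suc 0) = g (-1)" "interleave f g 2 = f 0"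
  by (simp_all add: interleave_def)

text \<open>A solution yields nonvanishing linear sequences; conversely, the ratios of two such
  sequences can be sorted by parity into \<open>x\<close> and \<open>y\<close>. This turns the
  forbidden set into a question about zeros of \<open>linrec\<close>.\<close>

lemma well_defined_solution_exists_iff:
  "(\<exists>x y. well_defined_solution a b c d x y \<and>
      x (-2) = p2 \<and> x (-1) = p1 \<and> x 0 = p0 \<and> y (-2) = q2 \<and> y (-1) = q1 \<and> y 0 = q0) \<longleftrightarrow>
   (\<forall>n. linrec a b c d q2 p1 q0 n \<noteq> 0 \<and> linrec a b c d p2 q1 p0 n \<noteq> 0)"
  (is "?L \<longleftrightarrow> ?R")
proof
  assume ?L
  then obtain x y where "well_defined_solution a b c d x y"
    and init: "x (-2) = p2" "x (-1) = p1" "x 0 = p0" "y (-2) = q2" "y (-1) = q1" "y 0 = q0"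
    by blast
  then have "riccati_solution a b c d (interleave y x)" "riccati_solution a b c d (interleave x y)"
    by (simp_all add: well_defined_solution_iff_interleave)
  from this[THEN riccati_solution_linrec(1)] show ?R
    by (simp add: init)
next
  assume nz: ?R
  define u where "u n = linrec a b c d q2 p1 q0 (Suc n) / linrec a b c d q2 p1 q0 n" for n
  define v where "v n = linrec a b c d p2 q1 p0 (Suc n) / linrec a b c d p2 q1 p0 n" for n
  \<comment> \<open>The interleaving is undone: \<open>u\<close> holds \<open>y\<close> at even and
    \<open>x\<close> at odd indices, \<open>v\<close> the reverse. Below -2 the truncation by
    \<open>nat\<close> yields \<open>u 0\<close> or \<open>v 0\<close>, values that are never
    inspected.\<close>
  define x where "x n = (if even n then v (nat (n + 2)) else u (nat (n + 2)))" for n :: int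
  define y where "y n = (if even n then u (nat (n + 2)) else v (nat (n + 2)))" for n :: int
  have "interleave y x = u" "interleave x y = v"
    by (auto simp: interleave_def x_def y_def fun_eq_iff)
  moreover have "riccati_solution a b c d u" "riccati_solution a b c d v"
    using nz unfolding u_def v_def by (auto intro!: linrec_riccati_solution)
  ultimately have "well_defined_solution a b c d x y"
    by (simp add: well_defined_solution_iff_interleave)
  \<comment> \<open>Nonvanishing at indices 1 and 2 allows cancelling the products in the ratios
    \<open>u 1, u 2, v 1, v 2\<close>.\<close>
  moreover have "u 0 = q2" "u 1 = p1" "u 2 = q0" "v 0 = p2" "v 1 = q1" "v 2 = p0"
    using nz[rule_format, of 1] nz[rule_format, of 2] by (simp_all add: u_def v_def numeral_eq_Suc)
  ultimately show ?L
    by (intro exI[of _ x] exI[of _ y]) (simp add: x_def y_def)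
qed

text \<open>The values at 0, 1, 2 are \<open>1\<close>, \<open>p\<close> and \<open>q * p\<close>,
  so zeros can occur only at the indices \<open>n + 3\<close> covered by the closed form.\<close>

lemma linrec_nonzero_iff:
  assumes "p \<noteq> 0" "q \<noteq> 0"
  shows "(\<forall>n. linrec a b c d p q r n \<noteq> 0) \<longleftrightarrow> (\<forall>n. linrec a b c d p q r (n + 3) \<noteq> 0)"
proof
  assume shifted: "\<forall>n. linrec a b c d p q r (n + 3) \<noteq> 0"
  have "linrec a b c d p q r n \<noteq> 0" if "n < 3" for n
    using that assms by (auto simp: numeral_eq_Suc less_Suc_eq)
  with shifted show "\<forall>n. linrec a b c d p q r n \<noteq> 0"
    by (metis le_add_diff_inverse2 not_less)
qed blast

theorem theorem1:
  fixes a b c d :: real and J :: "nat \<Rightarrow> real"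
  assumes "d \<noteq> 0"
    and "J 0 = 0" and "J 1 = 0" and "J 2 = 1" and "J 3 = a"
    and "\<And>n. J (n + 4) = a * J (n + 3) + b * J (n + 2) + c * J (n + 1) + d * J n"
  shows
    "(\<forall>x y. well_defined_solution a b c d x y \<longrightarrow>
        (\<forall>n::nat.
          x (2 * int n + 1) =
            (d * J (2 * n + 2) + (c * J (2 * n + 2) + d * J (2 * n + 1)) * y (-2) + (J (2 * n + 4) - a * J (2 * n + 3)) * x (-1) * y (-2) + J (2 * n + 3) * y 0 * x (-1) * y (-2))
            / (d * J (2 * n + 1) + (c * J (2 * n + 1) + d * J (2 * n)) * y (-2) + (J (2 * n + 3) - a * J (2 * n + 2)) * x (-1) * y (-2) + J (2 * n + 2) * y 0 * x (-1) * y (-2)) \<and>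
          x (2 * int n + 2) =
            (d * J (2 * n + 3) + (c * J (2 * n + 3) + d * J (2 * n + 2)) * x (-2) + (J (2 * n + 5) - a * J (2 * n + 4)) * y (-1) * x (-2) + J (2 * n + 4) * x 0 * y (-1) * x (-2))
            / (d * J (2 * n + 2) + (c * J (2 * n + 2) + d * J (2 * n + 1)) * x (-2) + (J (2 * n + 4) - a * J (2 * n + 3)) * y (-1) * x (-2) + J (2 * n + 3) * x 0 * y (-1) * x (-2)) \<and>
          y (2 * int n + 1) =
            (d * J (2 * n + 2) + (c * J (2 * n + 2) + d * J (2 * n + 1)) * x (-2) + (J (2 * n + 4) - a * J (2 * n + 3)) * y (-1) * x (-2) + J (2 * n + 3) * x 0 * y (-1) * x (-2))
            / (d * J (2 * n + 1) + (c * J (2 * n + 1) + d * J (2 * n)) * x (-2) + (J (2 * n + 3) - a * J (2 * n + 2)) * y (-1) * x (-2) + J (2 * n + 2) * x 0 * y (-1) * x (-2)) \<and>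
          y (2 * int n + 2) =
            (d * J (2 * n + 3) + (c * J (2 * n + 3) + d * J (2 * n + 2)) * y (-2) + (J (2 * n + 5) - a * J (2 * n + 4)) * x (-1) * y (-2) + J (2 * n + 4) * y 0 * x (-1) * y (-2))
            / (d * J (2 * n + 2) + (c * J (2 * n + 2) + d * J (2 * n + 1)) * y (-2) + (J (2 * n + 4) - a * J (2 * n + 3)) * x (-1) * y (-2) + J (2 * n + 3) * y 0 * x (-1) * y (-2)))) \<and>
     forbidden_set a b c d =
       (\<Union>n::nat. {(p2, p1, p0, q2, q1, q0).
          p2 \<noteq> 0 \<and> p1 \<noteq> 0 \<and> p0 \<noteq> 0 \<and> q2 \<noteq> 0 \<and> q1 \<noteq> 0 \<and> q0 \<noteq> 0 \<and>
          (d * J (n + 1) + (c * J (n + 1) + d * J n) * q2 + (J (n + 3) - a * J (n + 2)) * p1 * q2 + J (n + 2) * q0 * p1 * q2 = 0 \<or>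
           d * J (n + 1) + (c * J (n + 1) + d * J n) * p2 + (J (n + 3) - a * J (n + 2)) * q1 * p2 + J (n + 2) * p0 * q1 * p2 = 0)})"
proof (intro conjI allI impI)
  note J = assms(2-6)
  note closed = linrec_closed_form[OF J]
  {
    fix x y and n :: nat
    assume sol: "well_defined_solution a b c d x y"
    let ?A = "linrec a b c d (y (-2)) (x (-1)) (y 0)"
    let ?B = "linrec a b c d (x (-2)) (y (-1)) (x 0)"
    from sol have "riccati_solution a b c d (interleave y x)"
      "riccati_solution a b c d (interleave x y)"
      by (simp_all add: well_defined_solution_iff_interleave)
    from this[THEN riccati_solution_linrec(2)]
    have ratio: "interleave y x k = ?A (Suc k) / ?A k" "interleave x y k = ?B (Suc k) / ?B k" for k
      by simp_all
    \<comment> \<open>The closed form applies to arguments of the form \<open>m + 3\<close>. The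
      indices \<open>2 * n + 3\<close>, \<open>2 * n + 4\<close>, \<open>2 * n + 5\<close> occurring
      in the ratios correspond to \<open>m = 2 * n\<close>, \<open>2 * n + 1\<close>,
      \<open>2 * n + 2\<close>.\<close>
    have idx: "Suc (2 * n + 3) = (2 * n + 1) + 3" "2 * n + 4 = (2 * n + 1) + 3"
      "Suc ((2 * n + 1) + 3) = (2 * n + 2) + 3"
      by simp_all
    have shift: "2 * n + 1 + 1 = 2 * n + 2" "2 * n + 1 + 2 = 2 * n + 3" "2 * n + 1 + 3 = 2 * n + 4"
      "2 * n + 2 + 1 = 2 * n + 3" "2 * n + 2 + 2 = 2 * n + 4" "2 * n + 2 + 3 = 2 * n + 5"
      by simp_all
    have eval: "interleave f g (2 * n + 3) = g (2 * int n + 1)"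
      "interleave f g (2 * n + 4) = f (2 * int n + 2)" for f g
      by (simp_all add: interleave_def add.commute)
    \<comment> \<open>The first components come from \<open>interleave y x\<close> and give
      \<open>x\<close> at \<open>2n+1\<close> and \<open>y\<close> at \<open>2n+2\<close>; the
      second come from \<open>interleave x y\<close> and give \<open>y\<close> at
      \<open>2n+1\<close> and \<open>x\<close> at \<open>2n+2\<close>.\<close>
    note odd = ratio[of "2 * n + 3", unfolded eval, unfolded idx closed, unfolded shift]
    note even = ratio[of "2 * n + 4", unfolded eval, unfolded idx closed, unfolded shift]
    show "x (2 * int n + 1) =
            (d * J (2 * n + 2) + (c * J (2 * n + 2) + d * J (2 * n + 1)) * y (-2) + (J (2 * n + 4) - a * J (2 * n + 3)) * x (-1) * y (-2) + J (2 * n + 3) * y 0 * x (-1) * y (-2))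
            / (d * J (2 * n + 1) + (c * J (2 * n + 1) + d * J (2 * n)) * y (-2) + (J (2 * n + 3) - a * J (2 * n + 2)) * x (-1) * y (-2) + J (2 * n + 2) * y 0 * x (-1) * y (-2))"
      by (rule odd(1))
    show "y (2 * int n + 1) =
            (d * J (2 * n + 2) + (c * J (2 * n + 2) + d * J (2 * n + 1)) * x (-2) + (J (2 * n + 4) - a * J (2 * n + 3)) * y (-1) * x (-2) + J (2 * n + 3) * x 0 * y (-1) * x (-2))
            / (d * J (2 * n + 1) + (c * J (2 * n + 1) + d * J (2 * n)) * x (-2) + (J (2 * n + 3) - a * J (2 * n + 2)) * y (-1) * x (-2) + J (2 * n + 2) * x 0 * y (-1) * x (-2))"
      by (rule odd(2))
    show "x (2 * int n + 2) =
            (d * J (2 * n + 3) + (c * J (2 * n + 3) + d * J (2 * n + 2)) * x (-2) + (J (2 * n + 5) - a * J (2 * n + 4)) * y (-1) * x (-2) + J (2 * n + 4) * x 0 * y (-1) * x (-2))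
            / (d * J (2 * n + 2) + (c * J (2 * n + 2) + d * J (2 * n + 1)) * x (-2) + (J (2 * n + 4) - a * J (2 * n + 3)) * y (-1) * x (-2) + J (2 * n + 3) * x 0 * y (-1) * x (-2))"
      by (rule even(2))
    show "y (2 * int n + 2) =
            (d * J (2 * n + 3) + (c * J (2 * n + 3) + d * J (2 * n + 2)) * y (-2) + (J (2 * n + 5) - a * J (2 * n + 4)) * x (-1) * y (-2) + J (2 * n + 4) * y 0 * x (-1) * y (-2))
            / (d * J (2 * n + 2) + (c * J (2 * n + 2) + d * J (2 * n + 1)) * y (-2) + (J (2 * n + 4) - a * J (2 * n + 3)) * x (-1) * y (-2) + J (2 * n + 3) * y 0 * x (-1) * y (-2))"
      by (rule even(1))
  }
  \<comment> \<open>The nonzero assumptions concern the first two parameters of each linear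
    sequence, as required to restrict attention to indices \<open>n + 3\<close>.\<close>
  have no_solution_iff: "\<not> (\<exists>x y. well_defined_solution a b c d x y \<and>
        x (-2) = p2 \<and> x (-1) = p1 \<and> x 0 = p0 \<and> y (-2) = q2 \<and> y (-1) = q1 \<and> y 0 = q0) \<longleftrightarrow>
      (\<exists>n. linrec a b c d q2 p1 q0 (n + 3) = 0 \<or> linrec a b c d p2 q1 p0 (n + 3) = 0)"
    if "p2 \<noteq> 0" "p1 \<noteq> 0" "q2 \<noteq> 0" "q1 \<noteq> 0" for p2 p1 p0 q2 q1 q0
    unfolding well_defined_solution_exists_iff all_conj_distrib
      linrec_nonzero_iff[OF that(3,2)] linrec_nonzero_iff[OF that(1,4)]
    by blast
  have "(p2, p1, p0, q2, q1, q0) \<in> forbidden_set a b c d \<longleftrightarrow>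
      (p2, p1, p0, q2, q1, q0) \<in> (\<Union>n. {(p2, p1, p0, q2, q1, q0).
      p2 \<noteq> 0 \<and> p1 \<noteq> 0 \<and> p0 \<noteq> 0 \<and> q2 \<noteq> 0 \<and> q1 \<noteq> 0 \<and> q0 \<noteq> 0 \<and>
        (linrec a b c d q2 p1 q0 (n + 3) = 0 \<or> linrec a b c d p2 q1 p0 (n + 3) = 0)})"
    for p2 p1 p0 q2 q1 q0
    using no_solution_iff[of p2 p1 q2 q1 p0 q0]
    unfolding forbidden_set_def UN_iff mem_Collect_eq prod.case by blast
  then have "forbidden_set a b c d = (\<Union>n. {(p2, p1, p0, q2, q1, q0).
      p2 \<noteq> 0 \<and> p1 \<noteq> 0 \<and> p0 \<noteq> 0 \<and> q2 \<noteq> 0 \<and> q1 \<noteq> 0 \<and> q0 \<noteq> 0 \<and>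
      (linrec a b c d q2 p1 q0 (n + 3) = 0 \<or> linrec a b c d p2 q1 p0 (n + 3) = 0)})"
    by (simp only: set_eq_iff split_paired_All simp_thms)
  then show "forbidden_set a b c d =
       (\<Union>n::nat. {(p2, p1, p0, q2, q1, q0).
          p2 \<noteq> 0 \<and> p1 \<noteq> 0 \<and> p0 \<noteq> 0 \<and> q2 \<noteq> 0 \<and> q1 \<noteq> 0 \<and> q0 \<noteq> 0 \<and>
          (d * J (n + 1) + (c * J (n + 1) + d * J n) * q2 + (J (n + 3) - a * J (n + 2)) * p1 * q2 + J (n + 2) * q0 * p1 * q2 = 0 \<or>
           d * J (n + 1) + (c * J (n + 1) + d * J n) * p2 + (J (n + 3) - a * J (n + 2)) * q1 * p2 + J (n + 2) * p0 * q1 * p2 = 0)})"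
    \<comment> \<open>The closed form replaces the two \<open>linrec\<close> values at
      \<open>n + 3\<close> by \<open>A_n\<close> and \<open>B_n\<close>.\<close>
    unfolding closed .
qed

end
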